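(* Let $r\equiv2\pmod4$ be a positive integer and $n\ge2$. The map $p:A_{r,n}\to G_{\frac r2,n}$ is an epimorphism of groups. Moreover, the kernel of $p$ is the normal closure $\ll a_1^2\gg$ of $a_1^2$ in $A_{r,n}$. Thus $G_{\frac r2,n}\cong A_{r,n}/\ll a_1^2\gg$.
   Context: For positive integers $m,n$, $G_{m,n}=\mathbb{Z}_m\wr S_n$ is the set of pairs $(\vec z,\tau)$ with $\vec z=(z_1,\dots,z_n)\in\{0,\dots,m-1\}^n$, $\tau\in S_n$, with product $(\vec z,\tau)(\vec z',\tau')=((z_1+z'_{\tau^{-1}(1)},\dots,z_n+z'_{\tau^{-1}(n)}),\tau\circ\tau')$, addition mod $m$. For $\pi=(\vec z,\tau)$ put $c_i(\pi)=z_{\tau(i)}$ (the color of the digit in place $i$); the window notation is $\pi=(\tau(1)^{[c_1]}\cdots\tau(n)^{[c_n]})$. The generator $s_0$ is the pair with vector $(1,0,\dots,0)$ and identity permutation; for $1\le i\le n-1$, $s_i$ is the pair with zero vector and transposition $(i\ i+1)$. $A_{r,n}$ is the kernel of the homomorphism $G_{r,n}\to\{\pm1\}$ sending every $s_i$, $0\le i\le n-1$, to $-1$. Put $a_1=s_0^{r/2}s_1\in A_{r,n}$. For a nonnegative integer $a$, $a\oslash 2\in\{0,\dots,\frac r2-1\}$ is the residue modulo $\frac r2$ of $\frac a2$ if $a$ is even, and of $\frac{a+r/2}{2}$ if $a$ is odd. The map $p:A_{r,n}\to G_{\frac r2,n}$ is defined by $p\bigl((b_1^{[c_1]}\cdots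 b_n^{[c_n]})\bigr)=(b_1^{[c_1\oslash2]}\cdots b_n^{[c_n\oslash2]})$. *)

theory Defs
  imports "HOL-Algebra.Sym_Groups"
begin

text \<open>
  An element of \<open>\<int>\<^sub>m \<wr> S\<^sub>n\<close> is a pair \<open>(z, \<tau>)\<close> where \<open>z\<close> is a vector of residues indexed by
  \<open>{1..n}\<close> (an extensional function, so that equality of pairs is equality of vectors) and
  \<open>\<tau>\<close> is a permutation of \<open>{1..n}\<close>.
\<close>

type_synonym colored_perm = "(nat \<Rightarrow> nat) \<times> (nat \<Rightarrow> nat)"

definition wreath :: "nat \<Rightarrow> nat \<Rightarrow> colored_perm monoid" where
  "wreath m n = \<lparr>
     carrier = ({1..n} \<rightarrow>\<^sub>E {0..<m}) \<times> {\<tau>. \<tau> permutes {1..n}},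
     mult = (\<lambda>(z, \<tau>) (z', \<tau>'). (\<lambda>i\<in>{1..n}. (z i + z' (inv' \<tau> i)) mod m, \<tau> \<circ> \<tau>')),
     one = (\<lambda>i\<in>{1..n}. 0, id)\<rparr>"

text \<open>The residue \<open>1 mod m\<close> only matters for \<open>m = 1\<close>, where \<open>s\<^sub>0\<close> is the identity.\<close>

definition gen :: "nat \<Rightarrow> nat \<Rightarrow> nat \<Rightarrow> colored_perm" where
  "gen m n i =
     (if i = 0 then (\<lambda>j\<in>{1..n}. if j = 1 then 1 mod m else 0, id)
      else (\<lambda>j\<in>{1..n}. 0, Transposition.transpose i (i + 1)))"

definition digit :: "colored_perm \<Rightarrow> nat \<Rightarrow> nat" where
  "digit \<pi> i = snd \<pi> i"

definition color :: "colored_perm \<Rightarrow> nat \<Rightarrow> nat" where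
  "color \<pi> i = fst \<pi> (snd \<pi> i)"

text \<open>The element with window notation \<open>b\<^sub>1\<^bsup>[c\<^sub>1]\<^esup> \<cdots> b\<^sub>n\<^bsup>[c\<^sub>n]\<^esup>\<close>; see \<open>window_digit_color\<close> below.\<close>

definition window :: "nat \<Rightarrow> (nat \<Rightarrow> nat) \<Rightarrow> (nat \<Rightarrow> nat) \<Rightarrow> colored_perm" where
  "window n b c = (\<lambda>j\<in>{1..n}. c (inv' b j), b)"

text \<open>
  The homomorphism onto \<open>{\<plusminus>1}\<close> is unique only as a function on the carrier, hence the
  extensionality requirement. That it exists and is unique for even \<open>m\<close> and \<open>n \<ge> 1\<close> is
  \<open>sign_char_ex1\<close> below.
\<close>

definition is_sign_char :: "nat \<Rightarrow> nat \<Rightarrow> (colored_perm \<Rightarrow> int) \<Rightarrow> bool" where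
  "is_sign_char m n \<chi> \<longleftrightarrow>
     \<chi> \<in> hom (wreath m n) sign_img \<and> \<chi> \<in> extensional (carrier (wreath m n)) \<and>
     (\<forall>i<n. \<chi> (gen m n i) = -1)"

definition sign_char :: "nat \<Rightarrow> nat \<Rightarrow> colored_perm \<Rightarrow> int" where
  "sign_char m n = (THE \<chi>. is_sign_char m n \<chi>)"

definition alt_wreath :: "nat \<Rightarrow> nat \<Rightarrow> colored_perm monoid" where
  "alt_wreath r n =
     (wreath r n)\<lparr>carrier := kernel (wreath r n) sign_img (sign_char r n)\<rparr>"

definition a1 :: "nat \<Rightarrow> nat \<Rightarrow> colored_perm" where
  "a1 r n = (gen r n 0 [^]\<^bsub>wreath r n\<^esub> (r div 2)) \<otimes>\<^bsub>wreath r n\<^esub> gen r n 1"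

definition half_mod :: "nat \<Rightarrow> nat \<Rightarrow> nat" where
  "half_mod r a = (if even a then a div 2 else (a + r div 2) div 2) mod (r div 2)"

definition p_map :: "nat \<Rightarrow> nat \<Rightarrow> colored_perm \<Rightarrow> colored_perm" where
  "p_map r n \<pi> = window n (digit \<pi>) (\<lambda>i. half_mod r (color \<pi> i))"

definition normal_closure :: "('a, 'b) monoid_scheme \<Rightarrow> 'a set \<Rightarrow> 'a set" where
  "normal_closure G S = \<Inter>{N. N \<lhd> G \<and> S \<subseteq> N}"


lemma window_digit_color:
  assumes "\<pi> \<in> carrier (wreath m n)"
  shows "window n (digit \<pi>) (color \<pi>) = \<pi>"
proof -
  obtain z t where pi: "\<pi> = (z, t)" by (cases \<pi>)
  have z: "z \<in> {1..n} \<rightarrow>\<^sub>E {0..<m}" and t: "t permutes {1..n}"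
    using assms by (auto simp: pi wreath_def)
  have d: "digit \<pi> = t" by (auto simp: digit_def pi)
  have "color \<pi> (inv' t j) = z j" for j
    by (simp add: color_def pi permutes_inverses[OF t])
  moreover have "restrict z {1..n} = z"
    using z by (auto simp: PiE_def intro: extensional_restrict)
  ultimately show ?thesis
    unfolding window_def d by (simp only: pi)
qed

lemma wreath_group:
  assumes m: "m > 0"
  shows "group (wreath m n)"
proof (rule groupI)
  fix x y assume x: "x \<in> carrier (wreath m n)" and y: "y \<in> carrier (wreath m n)"
  then show "x \<otimes>\<^bsub>wreath m n\<^esub> y \<in> carrier (wreath m n)"
    using m by (auto simp: wreath_def permutes_compose)
next
  show "\<one>\<^bsub>wreath m n\<^esub> \<in> carrier (wreath m n)"
    using m by (auto simp: wreath_def permutes_id)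
next
  fix x y w
  assume x: "x \<in> carrier (wreath m n)" and y: "y \<in> carrier (wreath m n)"
    and w: "w \<in> carrier (wreath m n)"
  obtain z t where x': "x = (z, t)" by (cases x)
  obtain z' t' where y': "y = (z', t')" by (cases y)
  obtain z'' t'' where w': "w = (z'', t'')" by (cases w)
  have t: "t permutes {1..n}" "t' permutes {1..n}"
    using x y by (auto simp: x' y' wreath_def)
  have i: "inv' (t \<circ> t') i = inv' t' (inv' t i)" for i
    using t by (simp add: o_inv_distrib permutes_bij)
  have j: "Suc 0 \<le> inv' t i \<and> inv' t i \<le> n" if "Suc 0 \<le> i \<and> i \<le> n" for i
    using permutes_in_image[OF permutes_inv[OF t(1)], of i] that by auto
  show "x \<otimes>\<^bsub>wreath m n\<^esub> y \<otimes>\<^bsub>wreath m n\<^esub> w = x \<otimes>\<^bsub>wreath m n\<^esub> (y \<otimes>\<^bsub>wreath m n\<^esub> w)"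
    using j by (auto simp: x' y' w' wreath_def i fun_eq_iff mod_simps add.assoc)
next
  fix x assume x: "x \<in> carrier (wreath m n)"
  then show "\<one>\<^bsub>wreath m n\<^esub> \<otimes>\<^bsub>wreath m n\<^esub> x = x"
    by (auto simp: wreath_def fun_eq_iff PiE_iff extensional_def)
next
  fix x assume x: "x \<in> carrier (wreath m n)"
  obtain z t where x': "x = (z, t)" by (cases x)
  have t: "t permutes {1..n}" using x by (auto simp: x' wreath_def)
  have z: "z i < m" if "i \<in> {1..n}" for i using x that by (auto simp: x' wreath_def)
  have t': "inv' (inv' t) = t" using t by (simp add: permutes_bij inv_inv_eq)
  let ?y = "(\<lambda>i\<in>{1..n}. (m - z (t i)) mod m, inv' t)"
  have 1: "?y \<in> carrier (wreath m n)"
    using m t by (auto simp: wreath_def permutes_inv)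
  have 2: "((m - z (t i)) mod m + z (t i)) mod m = 0" if "i \<in> {1..n}" for i
    using z[of "t i"] that permutes_in_image[OF t, of i] by (simp add: mod_simps)
  have "?y \<otimes>\<^bsub>wreath m n\<^esub> x = \<one>\<^bsub>wreath m n\<^esub>"
    using 2 t by (auto simp: wreath_def x' fun_eq_iff t' permutes_inverses)
  with 1 show "\<exists>y\<in>carrier (wreath m n). y \<otimes>\<^bsub>wreath m n\<^esub> x = \<one>\<^bsub>wreath m n\<^esub>" by blast
qed

lemma gen_carrier:
  assumes "m > 0" "i < n"
  shows "gen m n i \<in> carrier (wreath m n)"
  using assms by (auto simp: gen_def wreath_def permutes_id intro!: permutes_swap_id)

lemma sign_char_exists:
  assumes m: "even m" "m > 0" and n: "n \<ge> 1"
  shows "is_sign_char m n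
    (\<lambda>(z, t) \<in> carrier (wreath m n). (-1) ^ (\<Sum>i\<in>{1..n}. z i) * sign t)"
    (is "is_sign_char m n ?c")
proof -
  interpret group "wreath m n" by (rule wreath_group[OF m(2)])
  have par: "(-1::int) ^ (\<Sum>i\<in>A. f i mod m) = (-1) ^ (\<Sum>i\<in>A. f i)"
    if "finite A" for f and A :: "nat set"
  proof -
    have "(-1::int) ^ (k mod m) = (-1) ^ k" for k
      using m(1) by (simp add: minus_one_power_iff dvd_mod_iff)
    then show ?thesis by (simp add: power_sum)
  qed
  have "?c (x \<otimes>\<^bsub>wreath m n\<^esub> y) = ?c x * ?c y"
    if x: "x \<in> carrier (wreath m n)" and y: "y \<in> carrier (wreath m n)" for x y
  proof -
    obtain z t where x': "x = (z, t)" by (cases x)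
    obtain z' t' where y': "y = (z', t')" by (cases y)
    have t: "t permutes {1..n}" "t' permutes {1..n}"
      using x y by (auto simp: x' y' wreath_def)
    have s: "sign (t \<circ> t') = sign t * sign t'"
      by (rule sign_compose) (use t in \<open>blast intro: permutes_imp_permutation\<close>)+
    have "(\<Sum>i\<in>{1..n}. z' (inv' t i)) = (\<Sum>i\<in>{1..n}. z' i)"
      using sum.permute[OF permutes_inv[OF t(1)], of z'] by (simp add: o_def)
    then have "(-1::int) ^ (\<Sum>i\<in>{1..n}. (z i + z' (inv' t i)) mod m)
        = (-1) ^ (\<Sum>i\<in>{1..n}. z i) * (-1) ^ (\<Sum>i\<in>{1..n}. z' i)"
      by (subst par) (simp_all add: sum.distrib power_add)
    moreover have "x \<otimes>\<^bsub>wreath m n\<^esub> y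
        = (\<lambda>i\<in>{1..n}. (z i + z' (inv' t i)) mod m, t \<circ> t')"
      by (simp add: x' y' wreath_def)
    ultimately show ?thesis
      using x y m_closed[OF x y] by (simp add: x' y' s)
  qed
  moreover have "?c x \<in> carrier sign_img" if "x \<in> carrier (wreath m n)" for x
    using that by (auto simp: sign_img_def sign_def minus_one_power_iff split: prod.splits)
  ultimately have "?c \<in> hom (wreath m n) sign_img"
    by (auto simp: hom_def sign_img_def)
  moreover have "?c (gen m n i) = -1" if "i < n" for i
  proof -
    have "m \<noteq> 1" using m by auto
    then have 0: "(\<Sum>j\<in>{1..n}. fst (gen m n i) j) = (if i = 0 then 1 else 0)"
      using n m by (simp add: gen_def)
    have "?c (gen m n i) = (-1) ^ (\<Sum>j\<in>{1..n}. fst (gen m n i) j) * sign (snd (gen m n i))"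
      using gen_carrier[OF m(2) that] by (simp add: case_prod_beta)
    also have "\<dots> = -1"
      unfolding 0 by (simp add: gen_def sign_swap_id)
    finally show ?thesis .
  qed
  ultimately show ?thesis by (simp add: is_sign_char_def)
qed

lemma wreath_generated:
  assumes m: "m > 0" and n: "n \<ge> 1"
    and H: "subgroup H (wreath m n)" and g: "\<And>i. i < n \<Longrightarrow> gen m n i \<in> H"
  shows "H = carrier (wreath m n)"
proof -
  let ?G = "wreath m n"
  interpret group ?G by (rule wreath_group[OF m])
  have cl: "x \<otimes>\<^bsub>?G\<^esub> y \<in> H" if "x \<in> H" "y \<in> H" for x y
    using subgroup.m_closed[OF H] that by blast
  let ?P = "\<lambda>t. (\<lambda>j\<in>{1..n}. 0, t) :: colored_perm"
  let ?V = "\<lambda>z. (z, id) :: colored_perm"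
  have PP: "?P s \<otimes>\<^bsub>?G\<^esub> ?P t = ?P (s \<circ> t)" if "s permutes {1..n}" for s t
    using permutes_in_image[OF permutes_inv[OF that]]
    by (auto simp: wreath_def fun_eq_iff)
  have tr: "Transposition.transpose i j permutes {1..n}"
    if "1 \<le> i" "i \<le> n" "1 \<le> j" "j \<le> n" for i j :: nat
    using that by (intro permutes_swap_id) auto
  have one: "?P id \<in> H" using subgroup.one_closed[OF H] by (simp add: wreath_def)
  have adj: "?P (Transposition.transpose i (Suc i)) \<in> H" if "1 \<le> i" "Suc i \<le> n" for i
    using g[of i] that by (simp add: gen_def)
  have T: "?P (Transposition.transpose i (i + Suc d)) \<in> H"
    if "1 \<le> i" "i + Suc d \<le> n" for i d
    using that(2)
  proof (induction d)
    case 0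
    have "i + Suc 0 = Suc i" by simp
    then show ?case using adj[OF that(1)] 0 by (metis (no_types, lifting))
  next
    case (Suc d)
    let ?s = "Transposition.transpose (i + Suc d) (Suc (i + Suc d))"
    let ?t = "Transposition.transpose i (i + Suc d)"
    have s: "?s permutes {1..n}" and t: "?t permutes {1..n}"
      by (rule tr; use Suc.prems that(1) in simp)+
    have "?s \<circ> (?t \<circ> ?s) = Transposition.transpose i (i + Suc (Suc d))"
      by (auto simp: fun_eq_iff Transposition.transpose_def)
    moreover have "?P ?s \<otimes>\<^bsub>?G\<^esub> (?P ?t \<otimes>\<^bsub>?G\<^esub> ?P ?s) \<in> H"
      by (intro cl adj Suc.IH) (use Suc.prems that(1) in simp_all)
    ultimately show ?case by (simp only: PP[OF s] PP[OF t])
  qed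
  have T': "?P (Transposition.transpose i j) \<in> H"
    if "i \<in> {1..n}" "j \<in> {1..n}" for i j
  proof (cases i j rule: linorder_cases)
    case less
    then obtain d where "j = i + Suc d" using less_iff_Suc_add by auto
    then show ?thesis using T[of i d] that by auto
  next
    case equal
    then show ?thesis using one by simp
  next
    case greater
    then obtain d where "i = j + Suc d" using less_iff_Suc_add by auto
    then show ?thesis using T[of j d] that by (auto simp: transpose_commute)
  qed
  have P: "?P t \<in> H" if t: "t permutes {1..n}" for t
    using t finite_atLeastAtMost
  proof (induction rule: permutes_induct)
    case id
    then show ?case by (rule one)
  next
    case (swap a b p)
    show ?case
      using cl[OF T'[OF swap(1,2)] swap.IH]
      unfolding PP[OF permutes_swap_id[OF swap(1,2)]] .
  qed
  let ?E = "\<lambda>i k. \<lambda>j\<in>{1..n}. if j = i then k mod m else 0"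
  have E1: "?V (?E 1 k) \<in> H" for k
  proof (induction k)
    case 0
    have "?E 1 0 = (\<lambda>j\<in>{1..n}. 0)" by auto
    then show ?case using one by metis
  next
    case (Suc k)
    have "?V (?E 1 k) \<otimes>\<^bsub>?G\<^esub> gen m n 0 = ?V (?E 1 (Suc k))"
      by (auto simp: wreath_def gen_def fun_eq_iff mod_simps)
    moreover have "gen m n 0 \<in> H" using g n by simp
    ultimately show ?case using cl[OF Suc] by metis
  qed
  have E: "?V (?E i k) \<in> H" if i: "i \<in> {1..n}" for i k
  proof -
    let ?t = "Transposition.transpose 1 i"
    have t: "?P ?t \<in> H" using T'[of 1 i] i by auto
    have "?P ?t \<otimes>\<^bsub>?G\<^esub> (?V (?E 1 k) \<otimes>\<^bsub>?G\<^esub> ?P ?t) = ?V (?E i k)"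
    proof -
      have "(?P ?t \<otimes>\<^bsub>?G\<^esub> (?V (?E 1 k) \<otimes>\<^bsub>?G\<^esub> ?P ?t)) =
        (\<lambda>j\<in>{1..n}. (0 + (\<lambda>l\<in>{1..n}. (?E 1 k l + 0) mod m) (?t j)) mod m, id)"
        using i by (auto simp: wreath_def fun_eq_iff)
      also have "\<dots> = ?V (?E i k)"
        using i by (auto simp: fun_eq_iff Transposition.transpose_def)
      finally show ?thesis .
    qed
    then show ?thesis using cl[OF t cl[OF E1 t]] by metis
  qed
  have V: "?V (\<lambda>j\<in>{1..n}. if j \<in> A then z j mod m else 0) \<in> H" if "A \<subseteq> {1..n}" for A z
    using finite_subset[OF that finite_atLeastAtMost] that
  proof (induction A rule: finite_induct)
    case empty
    have "(\<lambda>j\<in>{1..n}. if j \<in> {} then z j mod m else 0) = (\<lambda>j\<in>{1..n}. 0)" by auto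
    then show ?case using one by metis
  next
    case (insert a A)
    have "?V (\<lambda>j\<in>{1..n}. if j \<in> A then z j mod m else 0) \<otimes>\<^bsub>?G\<^esub> ?V (?E a (z a))
        = ?V (\<lambda>j\<in>{1..n}. if j \<in> insert a A then z j mod m else 0)"
      using insert.hyps by (auto simp: wreath_def fun_eq_iff)
    moreover have "a \<in> {1..n}" "A \<subseteq> {1..n}" using insert.prems by auto
    ultimately show ?case using cl[OF insert.IH E[of a "z a"]] by metis
  qed
  have "x \<in> H" if x: "x \<in> carrier ?G" for x
  proof -
    obtain z t where x': "x = (z, t)" by (cases x)
    have t: "t permutes {1..n}" and z: "z \<in> {1..n} \<rightarrow>\<^sub>E {0..<m}"
      using x by (auto simp: x' wreath_def)
    have "(\<lambda>j\<in>{1..n}. if j \<in> {1..n} then z j mod m else 0) = z"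
      using z by (auto simp: fun_eq_iff PiE_iff extensional_def)
    then have "?V z \<in> H" using V[OF order_refl, of z] by metis
    moreover have "?V z \<otimes>\<^bsub>?G\<^esub> ?P t = x"
      using z by (auto simp: x' wreath_def fun_eq_iff PiE_iff extensional_def)
    ultimately show ?thesis using cl[OF _ P[OF t]] by metis
  qed
  then show ?thesis using subgroup.subset[OF H] by blast
qed

lemma sign_char_ex1:
  assumes m: "even m" "m > 0" and n: "n \<ge> 1"
  shows "\<exists>!\<chi>. is_sign_char m n \<chi>"
proof -
  let ?G = "wreath m n"
  interpret group ?G by (rule wreath_group[OF m(2)])
  have "\<chi> = \<chi>'" if c: "is_sign_char m n \<chi>" and c': "is_sign_char m n \<chi>'" for \<chi> \<chi>'
  proof -
    interpret h: group_hom ?G sign_img \<chi>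
      using c is_group sign_img_is_group
      by (auto simp: is_sign_char_def group_hom_def group_hom_axioms_def)
    interpret h': group_hom ?G sign_img \<chi>'
      using c' is_group sign_img_is_group
      by (auto simp: is_sign_char_def group_hom_def group_hom_axioms_def)
    let ?H = "{x \<in> carrier ?G. \<chi> x = \<chi>' x}"
    have "subgroup ?H ?G"
    proof (rule subgroupI)
      have "\<one>\<^bsub>?G\<^esub> \<in> ?H" by simp
      then show "?H \<noteq> {}" by blast
    qed auto
    then have "?H = carrier ?G"
      by (rule wreath_generated[OF m(2) n])
        (use c c' gen_carrier[OF m(2)] in \<open>simp add: is_sign_char_def\<close>)
    then show ?thesis
      using c c' unfolding is_sign_char_def
      by (intro extensionalityI[of _ "carrier ?G"]) blast+
  qed
  then show ?thesis using sign_char_exists[OF assms] by blast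
qed

end

theory Submission
  imports Defs "HOL-Number_Theory.Cong"
begin

text \<open>
  Write \<open>r = 2 * q\<close> with \<open>q\<close> odd. The map \<open>a \<mapsto> a \<oslash> 2\<close> is reduction modulo \<open>q\<close> followed by
  multiplication with the inverse of 2, hence additive, and \<open>p\<close> applies it to every entry of the
  vector. The two preimages \<open>2 * w\<close> and \<open>2 * w + q\<close> of a residue \<open>w\<close> have different parities, so
  the first entry of a lift can be chosen to make it alternating. The kernel consists of the vectors
  \<open>q \<cdot> 1\<^sub>S\<close> with \<open>S\<close> of even size. As \<open>a\<^sub>1\<^sup>2 = q \<cdot> 1\<^bsub>{1,2}\<^esub>\<close> and conjugation by an element with
  underlying permutation \<open>\<tau>\<close> replaces \<open>S\<close> by \<open>\<tau>(S)\<close>, the conjugates of \<open>a\<^sub>1\<^sup>2\<close> are all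
  \<open>q \<cdot> 1\<^bsub>{i,j}\<^esub>\<close>, which generate the kernel.
\<close>

section \<open>Halving modulo an odd number\<close>

lemma half_mod_cong:
  assumes "odd q"
  shows "[2 * half_mod (2 * q) a = a] (mod q)"
proof (cases "even a")
  case True
  then show ?thesis
    by (simp add: half_mod_def cong_def mod_mult_right_eq)
next
  case False
  \<comment> \<open>Both \<open>a\<close> and \<open>q\<close> are odd here, so the division by 2 is
    exact, and adding \<open>q\<close> is invisible modulo \<open>q\<close>.\<close>
  with assms have "2 * ((a + q) div 2) = a + q" by simp
  moreover have "half_mod (2 * q) a = (a + q) div 2 mod q"
    using False by (simp add: half_mod_def)
  ultimately show ?thesis
    by (simp add: cong_def mod_mult_right_eq)
qed

lemma half_mod_less: "0 < q \<Longrightarrow> half_mod (2 * q) a < q"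
  by (simp add: half_mod_def)

text \<open>Since 2 is invertible modulo the odd \<open>q\<close>, a halved residue can be
  recognized by doubling it. Additivity, zeros and preimages of halving are all checked this
  way.\<close>

lemma half_mod_unique:
  assumes "odd q" "w < q" "[2 * w = a] (mod q)"
  shows "half_mod (2 * q) a = w"
proof -
  have "[2 * half_mod (2 * q) a = 2 * w] (mod q)"
    using half_mod_cong[OF assms(1), of a] assms(3) cong_sym cong_trans by blast
  then have "[half_mod (2 * q) a = w] (mod q)"
    using assms(1) by (simp add: cong_mult_lcancel_nat)
  then show ?thesis
    using assms half_mod_less[of q a] by (intro cong_less_modulus_unique_nat) auto
qed

lemma half_mod_add:
  assumes "odd q"
  shows "half_mod (2 * q) ((a + b) mod (2 * q))
    = (half_mod (2 * q) a + half_mod (2 * q) b) mod q"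
proof (rule half_mod_unique[OF assms])
  show "(half_mod (2 * q) a + half_mod (2 * q) b) mod q < q"
    using assms by (simp add: odd_pos)
  have "[2 * half_mod (2 * q) a + 2 * half_mod (2 * q) b = a + b] (mod q)"
    by (intro cong_add half_mod_cong assms)
  then show "[2 * ((half_mod (2 * q) a + half_mod (2 * q) b) mod q) = (a + b) mod (2 * q)] (mod q)"
    by (simp add: cong_def mod_mult_right_eq distrib_left mod_mod_cancel)
qed

text \<open>Halving to 0 forces \<open>q\<close> to divide \<open>a\<close>, and the only multiples
  of \<open>q\<close> below \<open>2 * q\<close> are 0 and \<open>q\<close>.\<close>

lemma half_mod_eq_0_iff:
  assumes "odd q" "a < 2 * q"
  shows "half_mod (2 * q) a = 0 \<longleftrightarrow> a = 0 \<or> a = q"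
proof
  assume "half_mod (2 * q) a = 0"
  then have "q dvd a"
    using half_mod_cong[OF assms(1), of a] by (simp add: cong_def mod_eq_0_iff_dvd)
  then obtain k where "a = q * k" by (elim dvdE)
  with assms have "k < 2" by simp
  with \<open>a = q * k\<close> show "a = 0 \<or> a = q" by (cases k) auto
next
  assume "a = 0 \<or> a = q"
  then show "half_mod (2 * q) a = 0"
    using assms by (intro half_mod_unique) (auto simp: cong_def odd_pos)
qed

section \<open>The alternating subgroup and the map \<open>p\<close>\<close>

lemma wreath_carrier_iff:
  "(z, t) \<in> carrier (wreath m n) \<longleftrightarrow> z \<in> {1..n} \<rightarrow>\<^sub>E {0..<m} \<and> t permutes {1..n}"
  by (simp add: wreath_def)

lemma wreath_mult:
  "(z, t) \<otimes>\<^bsub>wreath m n\<^esub> (z', t') = (\<lambda>i\<in>{1..n}. (z i + z' (inv' t i)) mod m, t \<circ> t')"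
  by (simp add: wreath_def)

lemma alt_wreath_mult [simp]: "mult (alt_wreath m n) = mult (wreath m n)"
  by (simp add: alt_wreath_def)

lemma alt_wreath_one [simp]: "one (alt_wreath m n) = one (wreath m n)"
  by (simp add: alt_wreath_def)

text \<open>Replaces the definite description by a formula, so that membership in the alternating
  subgroup becomes a parity condition on the color sum and the permutation.\<close>

lemma sign_char_eq:
  assumes "even m" "m > 0" "n \<ge> 1"
  shows "sign_char m n = (\<lambda>(z, t) \<in> carrier (wreath m n). (-1) ^ (\<Sum>i\<in>{1..n}. z i) * sign t)"
  unfolding sign_char_def
  by (rule the1_equality[where P = "is_sign_char m n", OF sign_char_ex1[OF assms] sign_char_exists[OF assms]])

lemma alt_wreath_carrier_iff:
  assumes "even m" "m > 0" "n \<ge> 1"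
  shows "(z, t) \<in> carrier (alt_wreath m n) \<longleftrightarrow>
    (z, t) \<in> carrier (wreath m n) \<and> (-1) ^ (\<Sum>i\<in>{1..n}. z i) * sign t = 1"
  by (auto simp: alt_wreath_def kernel_def sign_char_eq[OF assms] sign_img_def)

lemma alt_wreath_group:
  assumes "even m" "m > 0" "n \<ge> 1"
  shows "group (alt_wreath m n)"
proof -
  interpret group "wreath m n" by (rule wreath_group[OF assms(2)])
  interpret h: group_hom "wreath m n" sign_img "sign_char m n"
    using sign_char_exists[OF assms] is_group sign_img_is_group
    by (simp add: sign_char_eq[OF assms] is_sign_char_def group_hom_def group_hom_axioms_def)
  show ?thesis
    unfolding alt_wreath_def by (rule subgroup_imp_group[OF h.subgroup_kernel])
qed

text \<open>Colors are read off through \<open>t\<close> and written back through its inverse; the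
  two cancel, leaving an entrywise map on the vector.\<close>

lemma p_map_eq:
  assumes "t permutes {1..n}"
  shows "p_map r n (z, t) = (\<lambda>j\<in>{1..n}. half_mod r (z j), t)"
proof -
  have "digit (z, t) = t" by (auto simp: digit_def)
  then show ?thesis
    by (simp add: p_map_def window_def color_def permutes_inverses[OF assms])
qed

lemma p_map_hom:
  assumes "odd q"
  shows "p_map (2 * q) n \<in> hom (wreath (2 * q) n) (wreath q n)"
proof (rule homI)
  fix x assume "x \<in> carrier (wreath (2 * q) n)"
  then show "p_map (2 * q) n x \<in> carrier (wreath q n)"
    using assms by (cases x) (auto simp: wreath_carrier_iff p_map_eq half_mod_less odd_pos)
next
  fix x y assume x: "x \<in> carrier (wreath (2 * q) n)" and y: "y \<in> carrier (wreath (2 * q) n)"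
  obtain z t z' t' where xy: "x = (z, t)" "y = (z', t')" by (cases x, cases y)
  with x y have t: "t permutes {1..n}" "t' permutes {1..n}"
    by (auto simp: wreath_carrier_iff)
  show "p_map (2 * q) n (x \<otimes>\<^bsub>wreath (2 * q) n\<^esub> y)
      = p_map (2 * q) n x \<otimes>\<^bsub>wreath q n\<^esub> p_map (2 * q) n y"
  proof -
    have "t \<circ> t' permutes {1..n}" using t(2,1) by (rule permutes_compose)
    moreover have "inv' t i \<in> {1..n}" if "i \<in> {1..n}" for i
      using permutes_in_image[OF permutes_inv[OF t(1)]] that by blast
    ultimately show ?thesis
      unfolding xy wreath_mult p_map_eq[OF t(1)] p_map_eq[OF t(2)]
      by (simp add: p_map_eq wreath_mult half_mod_add[OF assms] cong: restrict_cong)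
  qed
qed

lemma p_map_alt_group_hom:
  assumes "odd q" "n \<ge> 1"
  shows "group_hom (alt_wreath (2 * q) n) (wreath q n) (p_map (2 * q) n)"
proof -
  have "0 < q" using assms(1) by (rule odd_pos)
  have "p_map (2 * q) n \<in> hom (alt_wreath (2 * q) n) (wreath q n)"
    using p_map_hom[OF assms(1), of n]
    by (auto simp: hom_def alt_wreath_def kernel_def)
  with \<open>0 < q\<close> assms(2) show ?thesis
    by (simp add: group_hom_def group_hom_axioms_def alt_wreath_group wreath_group)
qed

lemma p_map_alt_surj:
  assumes q: "odd q" and n: "n \<ge> 1" and y: "y \<in> carrier (wreath q n)"
  shows "\<exists>x\<in>carrier (alt_wreath (2 * q) n). p_map (2 * q) n x = y"
proof -
  obtain w t where y': "y = (w, t)" by (cases y)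
  have w: "w \<in> {1..n} \<rightarrow>\<^sub>E {0..<q}" and t: "t permutes {1..n}"
    using y by (auto simp: y' wreath_carrier_iff)
  have q0: "0 < q" using q by (rule odd_pos)
  \<comment> \<open>Doubling yields even entries only. For odd \<open>t\<close> the odd shift
    \<open>q\<close> makes the first entry odd and so corrects the sign, without changing the halved
    value.\<close>
  define z where "z = (\<lambda>j\<in>{1..n}. if j = 1 \<and> sign t = -1 then (2 * w j + q) mod (2 * q) else 2 * w j)"
  have "z j < 2 * q" if "j \<in> {1..n}" for j
    using w q0 that by (auto simp: z_def PiE_iff)
  then have zt: "(z, t) \<in> carrier (wreath (2 * q) n)"
    using t by (auto simp: wreath_carrier_iff z_def)
  have "{1..n} = insert 1 {2..n}" using n by auto
  then have "(\<Sum>i\<in>{1..n}. z i) = z 1 + (\<Sum>i\<in>{2..n}. z i)" by simp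
  moreover have "even (\<Sum>i\<in>{2..n}. z i)" by (rule dvd_sum) (auto simp: z_def)
  moreover have "even (z 1) \<longleftrightarrow> sign t = 1"
    using q n by (cases t rule: sign_cases) (simp_all add: z_def dvd_mod_iff)
  ultimately have "(-1) ^ (\<Sum>i\<in>{1..n}. z i) * sign t = 1"
    by (cases t rule: sign_cases) (simp_all add: minus_one_power_iff)
  with zt have "(z, t) \<in> carrier (alt_wreath (2 * q) n)"
    using q0 n by (simp add: alt_wreath_carrier_iff)
  moreover have "half_mod (2 * q) (z j) = w j" if "j \<in> {1..n}" for j
    using w that
    by (intro half_mod_unique q) (auto simp: z_def PiE_iff cong_def mod_mod_cancel)
  then have "p_map (2 * q) n (z, t) = y"
    using w t by (auto simp: p_map_eq y' fun_eq_iff PiE_iff extensional_def)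
  ultimately show ?thesis by blast
qed

section \<open>The kernel\<close>

definition flip :: "nat \<Rightarrow> nat \<Rightarrow> nat set \<Rightarrow> colored_perm" where
  "flip q n S = (\<lambda>j\<in>{1..n}. if j \<in> S then q else 0, id)"

lemma flip_wreath_carrier: "0 < q \<Longrightarrow> flip q n S \<in> carrier (wreath (2 * q) n)"
  by (auto simp: flip_def wreath_carrier_iff permutes_id)

lemma flip_empty: "flip q n {} = \<one>\<^bsub>wreath (2 * q) n\<^esub>"
  by (simp add: flip_def wreath_def)

lemma flip_mult:
  "S \<inter> T = {} \<Longrightarrow> 0 < q \<Longrightarrow> flip q n S \<otimes>\<^bsub>wreath (2 * q) n\<^esub> flip q n T = flip q n (S \<union> T)"
  by (auto simp: flip_def wreath_mult fun_eq_iff)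

text \<open>This is the conjugation rule without inverses: in this form it carries over to
  \<open>alt_wreath\<close>, which has the same multiplication. The vector \<open>z\<close> does not
  affect the outcome because addition of colors commutes.\<close>

lemma flip_commute:
  assumes "t permutes {1..n}"
  shows "(z, t) \<otimes>\<^bsub>wreath (2 * q) n\<^esub> flip q n S
    = flip q n (t ` S) \<otimes>\<^bsub>wreath (2 * q) n\<^esub> (z, t)"
proof -
  have "inv' t i \<in> S \<longleftrightarrow> i \<in> t ` S" for i
    using permutes_inverses[OF assms] by (metis imageE image_eqI)
  then show ?thesis
    using permutes_in_image[OF permutes_inv[OF assms]]
    by (auto simp: flip_def wreath_mult fun_eq_iff add.commute)
qed

text \<open>The color sum is \<open>card S * q\<close> with \<open>q\<close> odd, and the identity
  permutation has sign 1.\<close>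

lemma flip_alt_wreath_carrier_iff:
  assumes "odd q" "n \<ge> 1" "S \<subseteq> {1..n}"
  shows "flip q n S \<in> carrier (alt_wreath (2 * q) n) \<longleftrightarrow> even (card S)"
proof -
  have "(\<Sum>i\<in>{1..n}. if i \<in> S then q else 0) = card S * q"
    using assms(3) by (simp add: sum.If_cases Int_absorb1)
  then show ?thesis
    using assms(1,2) flip_wreath_carrier[of q n S]
    by (auto simp: flip_def alt_wreath_carrier_iff odd_pos minus_one_power_iff)
qed

lemma kernel_p_map:
  assumes q: "odd q" and n: "n \<ge> 1"
  shows "kernel (alt_wreath (2 * q) n) (wreath q n) (p_map (2 * q) n)
    = {flip q n S |S. S \<subseteq> {1..n} \<and> even (card S)}" (is "?K = ?F")
proof
  show "?K \<subseteq> ?F"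
  proof
    fix x assume x: "x \<in> ?K"
    obtain z t where x': "x = (z, t)" by (cases x)
    have q0: "0 < q" using q by (rule odd_pos)
    have alt: "(z, t) \<in> carrier (alt_wreath (2 * q) n)"
      and p: "p_map (2 * q) n (z, t) = \<one>\<^bsub>wreath q n\<^esub>"
      using x by (auto simp: kernel_def x')
    then have z: "z \<in> {1..n} \<rightarrow>\<^sub>E {0..<2 * q}" and t: "t permutes {1..n}"
      using q0 n by (auto simp: alt_wreath_carrier_iff wreath_carrier_iff)
    have eq: "(\<lambda>j\<in>{1..n}. half_mod (2 * q) (z j)) = (\<lambda>j\<in>{1..n}. 0)" and "t = id"
      using p by (simp_all add: p_map_eq[OF t] wreath_def)
    have h: "half_mod (2 * q) (z j) = 0" if "j \<in> {1..n}" for j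
      using fun_cong[OF eq, of j] that by simp
    have zj: "z j = 0 \<or> z j = q" if "j \<in> {1..n}" for j
      using h[OF that] half_mod_eq_0_iff[OF q] z that by (auto simp: PiE_iff)
    let ?S = "{j \<in> {1..n}. z j = q}"
    have "(z, t) = flip q n ?S"
      using z zj \<open>t = id\<close> by (auto simp: flip_def fun_eq_iff PiE_iff extensional_def)
    moreover have "?S \<subseteq> {1..n}" by blast
    moreover from calculation alt have "even (card ?S)"
      using flip_alt_wreath_carrier_iff[OF q n, of ?S] by metis
    ultimately show "x \<in> ?F" unfolding x' by blast
  qed
next
  have "p_map (2 * q) n (flip q n S) = \<one>\<^bsub>wreath q n\<^esub>" for S
    using q half_mod_eq_0_iff[OF q, of q] half_mod_eq_0_iff[OF q, of 0]
    by (auto simp: flip_def p_map_eq permutes_id wreath_def fun_eq_iff odd_pos)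
  then show "?F \<subseteq> ?K"
    using flip_alt_wreath_carrier_iff[OF q n] by (auto simp: kernel_def)
qed

section \<open>The normal closure of \<open>a_1^2\<close>\<close>

lemma gen_0_pow:
  "gen m n 0 [^]\<^bsub>wreath m n\<^esub> (k::nat) = (\<lambda>j\<in>{1..n}. if j = 1 then k mod m else 0, id)"
proof (induction k)
  case 0
  then show ?case by (auto simp: wreath_def nat_pow_def)
next
  case (Suc k)
  then show ?case
    by (auto simp: nat_pow_def gen_def wreath_mult fun_eq_iff mod_simps)
qed

text \<open>The transposition carries the entry \<open>q\<close> from position 1 to position 2 in
  the second factor, and squares to the identity.\<close>

lemma a1_squared:
  assumes "0 < q" "n \<ge> 2"
  shows "a1 (2 * q) n [^]\<^bsub>alt_wreath (2 * q) n\<^esub> (2::nat) = flip q n {1, 2}"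
proof -
  let ?s = "Transposition.transpose 1 2 :: nat \<Rightarrow> nat"
  have "gen (2 * q) n 1 = (\<lambda>j\<in>{1..n}. 0, ?s)"
    by (simp add: gen_def numeral_2_eq_2)
  then have "a1 (2 * q) n = (\<lambda>j\<in>{1..n}. if j = 1 then q else 0, ?s)"
    using assms by (auto simp: a1_def gen_0_pow wreath_mult fun_eq_iff)
  moreover have "x [^]\<^bsub>alt_wreath (2 * q) n\<^esub> (2::nat)
      = (\<one>\<^bsub>wreath (2 * q) n\<^esub> \<otimes>\<^bsub>wreath (2 * q) n\<^esub> x) \<otimes>\<^bsub>wreath (2 * q) n\<^esub> x" for x
    by (simp add: nat_pow_def numeral_2_eq_2)
  ultimately show ?thesis
    using assms
    by (auto simp: flip_def wreath_def fun_eq_iff Transposition.transpose_def)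
qed

text \<open>Strong induction on the size of \<open>S\<close>: a nonempty set of even size contains
  two distinct elements, and splitting them off factors \<open>flip q n S\<close> into a pair and a
  smaller even set.\<close>

lemma flip_mem_normal:
  assumes q: "odd q" and N: "N \<lhd> alt_wreath (2 * q) n" and a: "flip q n {1, 2} \<in> N"
    and n: "n \<ge> 2"
  shows "S \<subseteq> {1..n} \<Longrightarrow> even (card S) \<Longrightarrow> flip q n S \<in> N"
proof (induction "card S" arbitrary: S rule: less_induct)
  case less
  let ?A = "alt_wreath (2 * q) n"
  interpret normal N ?A by (rule N)
  have q0: "0 < q" using q by (rule odd_pos)
  have n1: "n \<ge> 1" using n by simp
  have pair: "flip q n {i, j} \<in> N" if ij: "i \<in> {1..n}" "j \<in> {1..n}" "i \<noteq> j" for i j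
  proof -
    \<comment> \<open>The permutation \<open>?t\<close> sends 1 to \<open>i\<close> and 2 to
      \<open>j\<close>: after \<open>?s\<close>, the second transposition moves \<open>?s 2\<close>
      to \<open>j\<close> and fixes \<open>i\<close>, which differs from both.\<close>
    let ?s = "Transposition.transpose 1 i :: nat \<Rightarrow> nat"
    let ?t = "Transposition.transpose (?s 2) j \<circ> ?s"
    have s1: "?s permutes {1..n}"
      using ij(1) n by (intro permutes_swap_id) simp_all
    then have "?s 2 \<in> {1..n}" using n by (simp only: permutes_in_image) auto
    with ij(2) have t: "?t permutes {1..n}"
      by (intro permutes_compose[OF s1] permutes_swap_id)
    have t12: "?t ` {1, 2} = {i, j}"
      using ij by (auto simp: Transposition.transpose_def)
    \<comment> \<open>Surjectivity of \<open>p\<close> supplies an alternating element with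
      permutation \<open>?t\<close>, whatever the sign of \<open>?t\<close>; its colors do not
      matter for the conjugation.\<close>
    have "(\<lambda>j\<in>{1..n}. 0, ?t) \<in> carrier (wreath q n)"
      using t q0 by (simp add: wreath_carrier_iff)
    then obtain g where g: "g \<in> carrier ?A" "p_map (2 * q) n g = (\<lambda>j\<in>{1..n}. 0, ?t)"
      using p_map_alt_surj[OF q, of n] n1 by blast
    obtain z s where g': "g = (z, s)" by (cases g)
    have s: "s permutes {1..n}"
      using g(1) n q0 by (simp add: g' alt_wreath_carrier_iff wreath_carrier_iff)
    then have "s = ?t" using g(2) by (simp add: g' p_map_eq)
    then have "g \<otimes>\<^bsub>?A\<^esub> flip q n {1, 2} = flip q n {i, j} \<otimes>\<^bsub>?A\<^esub> g"
      using flip_commute[OF s, of q z "{1, 2}"] t12 by (simp only: g' alt_wreath_mult)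
    moreover have "flip q n {i, j} \<in> carrier ?A"
      using flip_alt_wreath_carrier_iff[OF q, of n "{i, j}"] ij n by simp
    moreover have "flip q n {1, 2} \<in> carrier ?A" using a by (rule mem_carrier)
    ultimately have "g \<otimes>\<^bsub>?A\<^esub> flip q n {1, 2} \<otimes>\<^bsub>?A\<^esub> inv\<^bsub>?A\<^esub> g = flip q n {i, j}"
      using g(1) by (simp add: m_assoc del: alt_wreath_mult alt_wreath_one)
    then show ?thesis using inv_op_closed2[OF g(1) a] by simp
  qed
  show ?case
  proof (cases "S = {}")
    case True
    then show ?thesis using subgroup.one_closed[OF subgroup_axioms] by (simp add: flip_empty[of q n])
  next
    case False
    have fin: "finite S" using less.prems(1) by (rule finite_subset) simp
    obtain i where i: "i \<in> S" using False by auto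
    have "S \<noteq> {i}" using less.prems(2) by auto
    then obtain j where j: "j \<in> S" "i \<noteq> j" using i by auto
    let ?T = "S - {i, j}"
    have S: "S = {i, j} \<union> ?T" using i j by auto
    have "card S = 2 + card ?T"
      using i j fin by (subst S, subst card_Un_disjoint) auto
    then have "flip q n ?T \<in> N"
      using less.prems by (intro less.hyps) auto
    moreover have "flip q n {i, j} \<in> N"
      using less.prems i j by (intro pair) auto
    ultimately have "flip q n {i, j} \<otimes>\<^bsub>?A\<^esub> flip q n ?T \<in> N"
      by (rule subgroup.m_closed[OF subgroup_axioms, rotated])
    then show ?thesis using flip_mult[of "{i, j}" ?T q n] S q0 by simp
  qed
qed

lemma normal_closure_eqI:
  assumes "K \<lhd> G" "S \<subseteq> K" "\<And>N. N \<lhd> G \<Longrightarrow> S \<subseteq> N \<Longrightarrow> K \<subseteq> N"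
  shows "normal_closure G S = K"
  unfolding normal_closure_def
proof (rule antisym)
  show "\<Inter>{N. N \<lhd> G \<and> S \<subseteq> N} \<subseteq> K" using assms(1,2) by (intro Inter_lower) simp
  show "K \<subseteq> \<Inter>{N. N \<lhd> G \<and> S \<subseteq> N}" using assms(3) by (intro Inter_greatest) simp
qed

theorem lemma6p2:
  fixes r n :: nat
  assumes "r > 0" and "r mod 4 = 2" and "n \<ge> 2"
  shows "group_hom (alt_wreath r n) (wreath (r div 2) n) (p_map r n)
    \<and> p_map r n \<in> epi (alt_wreath r n) (wreath (r div 2) n)
    \<and> kernel (alt_wreath r n) (wreath (r div 2) n) (p_map r n)
        = normal_closure (alt_wreath r n) {a1 r n [^]\<^bsub>alt_wreath r n\<^esub> (2::nat)}
    \<and> wreath (r div 2) n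
        \<cong> alt_wreath r n Mod normal_closure (alt_wreath r n) {a1 r n [^]\<^bsub>alt_wreath r n\<^esub> (2::nat)}"
proof -
  define q where "q = r div 2"
  \<comment> \<open>The condition \<open>r mod 4 = 2\<close> says exactly that \<open>r\<close> is
    twice an odd number.\<close>
  have r: "r = 2 * q" and q: "odd q"
    unfolding q_def using assms(2) by presburger+
  have n: "n \<ge> 1" using assms(3) by simp
  have q': "2 * q div 2 = q" by simp
  let ?A = "alt_wreath (2 * q) n" and ?B = "wreath q n" and ?p = "p_map (2 * q) n"
  interpret p: group_hom ?A ?B ?p by (rule p_map_alt_group_hom[OF q n])
  have surj: "?p ` carrier ?A = carrier ?B"
    using p_map_alt_surj[OF q n] by (intro equalityI image_subsetI subsetI p.hom_closed) blast+
  have ker: "normal_closure ?A {a1 (2 * q) n [^]\<^bsub>?A\<^esub> (2::nat)} = kernel ?A ?B ?p"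
    unfolding a1_squared[OF odd_pos[OF q] assms(3)]
  proof (rule normal_closure_eqI)
    show "kernel ?A ?B ?p \<lhd> ?A" by (rule p.normal_kernel)
    have "{1, 2} \<subseteq> {1..n}" "even (card {1, 2::nat})" using assms(3) by auto
    then show "{flip q n {1, 2}} \<subseteq> kernel ?A ?B ?p"
      unfolding kernel_p_map[OF q n] by blast
  next
    fix N assume "N \<lhd> ?A" "{flip q n {1, 2}} \<subseteq> N"
    then show "kernel ?A ?B ?p \<subseteq> N"
      unfolding kernel_p_map[OF q n] using flip_mem_normal[OF q _ _ assms(3)] by blast
  qed
  \<comment> \<open>The first isomorphism theorem maps the quotient to \<open>?B\<close>; the goal
    wants the opposite direction, and inverting the isomorphism uses that the quotient is a
    group.\<close>
  have "?A Mod kernel ?A ?B ?p \<cong> ?B" by (rule p.FactGroup_iso[OF surj])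
  then have "?B \<cong> ?A Mod kernel ?A ?B ?p"
    by (rule group.iso_sym[OF normal.factorgroup_is_group[OF p.normal_kernel]])
  then show ?thesis
    unfolding r q' ker using p.group_hom_axioms surj p.homh by (simp add: epi_def)
qed

end
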